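(* Let $T\subseteq X_0$ be a generalised nice set with $\langle P_{\{1,2,1\}}\rangle\subseteq T$. Then: (i) If $|T\cap X_E|=2$, then $|T\cap X|\in\{2,4,6,10\}$; more precisely: if $|T\cap X|=2$ then $T\cap X=\{\{1,2\},\{1,5\}\}$; if $|T\cap X|=4$ then $T\cap X=\{\{1,2\},\{1,k\},\{1,5\},\{1,k*1\}\}$ for some $k\in\{3,4,6,7\}$; if $|T\cap X|=6$ then $T\cap X=X_{(1)}=\{\{1,l\}:l=2,\dots,7\}$; if $|T\cap X|=10$ then $T\cap X$ equals $T_{(1,j,k)}$ or $T_{(1,j*k,k)}$ for some $j\in\{2,5\}$ and $k\in\{3,4,6,7\}$. (ii) If $|T\cap X_E|>2$, then $|T\cap X|\in\{3,15,21\}$; more precisely: if $|T\cap X|=3$ then $T\cap X=X_{\ell_{12}}$; if $|T\cap X|=15$ then there is $s\in I\setminus\{1\}$ with $T\cap X=X\setminus X_{\ell_{1s}^C}$; if $|T\cap X|=21$ then $T\cap X=X$.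
   Context: Let $I=\{1,\dots,7\}$ and $I_0=I\cup\{0\}$. The Fano plane on $I$ has the seven lines $\{1,2,5\},\{5,6,7\},\{1,4,7\},\{1,3,6\},\{2,4,6\},\{2,3,7\},\{3,4,5\}$. For distinct $i,j\in I$, $i*j$ is the third point of the unique line containing $i$ and $j$, and $\ell_{ij}=\{i,j,i*j\}$. The operation is extended to $I_0$ by $0*i=i*0=i$ and $i*i=0$ for all $i\in I_0$. Three pairwise distinct $i,j,k\in I$ are generative if $k\neq i*j$. Let $X_0$ be the set of unordered pairs $\{i,j\}$ with $i,j\in I_0$, where $i=j$ is allowed; $X=\{\{i,j\}:i,j\in I,\ i\neq j\}$, $X_E=\{\{i,i\}:i\in I_0\}$. For a line $\ell$, $X_\ell=\{\{i,j\}\in X:i,j\in\ell\}$ and $X_{\ell^C}=\{\{i,j\}\in X:i,j\notin\ell\}$; for $i\in I$, $X_{(i)}=\{\{i,j\}\in X: j\neq i\}$. For $i,j,k\in I_0$ let $P_{\{i,j,k\}}=\{\{i,j\},\{j,k\},\{k,i\},\{i,j*k\},\{j,k*i\},\{k,i*j\}\}\subseteq X_0$. For generative $i,j,k\in I$, $T_{(i,j,k)}=P_{\{i,j,k\}}\cup\{\{i,i*j\},\{i,i*k\},\{i*j,i*k\},\{i,i*j*k\}\}$. A subset $T\subseteq X_0$ is a generalised nice set if for all $i,j,k\in I_0$, $\{i,j\}\in T$ and $\{i*j,k\}\in T$ imply $P_{\{i,j,k\}}\subseteq T$. For $S\subseteq X_0$, $\langle S\rangle$ denotes the smallest generalised nice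 set containing $S$. *)

theory Defs
  imports Main
begin

text \<open>An unordered pair is encoded as the set \<open>{i, j}\<close>; the degenerate pair \<open>{i, i}\<close>
  is then the singleton \<open>{i}\<close>.\<close>

definition idx :: "nat set" where
  "idx = {1..7}"

definition idx0 :: "nat set" where
  "idx0 = idx \<union> {0}"

definition fano_lines :: "nat set set" where
  "fano_lines = {{1,2,5}, {5,6,7}, {1,4,7}, {1,3,6}, {2,4,6}, {2,3,7}, {3,4,5}}"

text \<open>Only the values of \<open>fano_op\<close> on \<open>idx0\<close> are meaningful.\<close>

definition fano_op :: "nat \<Rightarrow> nat \<Rightarrow> nat" (infixl "\<star>" 70) where
  "i \<star> j =
    (if i = 0 then j
     else if j = 0 then i
     else if i = j then 0
     else (THE k. k \<noteq> i \<and> k \<noteq> j \<and> {i, j, k} \<in> fano_lines))"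

definition line_through :: "nat \<Rightarrow> nat \<Rightarrow> nat set" where
  "line_through i j = {i, j, i \<star> j}"

definition X0 :: "nat set set" where
  "X0 = {{i, j} | i j. i \<in> idx0 \<and> j \<in> idx0}"

definition X :: "nat set set" where
  "X = {{i, j} | i j. i \<in> idx \<and> j \<in> idx \<and> i \<noteq> j}"

definition XE :: "nat set set" where
  "XE = {{i, i} | i. i \<in> idx0}"

definition X_line :: "nat set \<Rightarrow> nat set set" where
  "X_line l = {{i, j} | i j. {i, j} \<in> X \<and> i \<in> l \<and> j \<in> l}"

definition X_line_compl :: "nat set \<Rightarrow> nat set set" where
  "X_line_compl l = {{i, j} | i j. {i, j} \<in> X \<and> i \<notin> l \<and> j \<notin> l}"

definition X_point :: "nat \<Rightarrow> nat set set" where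
  "X_point i = {{i, j} | j. {i, j} \<in> X \<and> j \<noteq> i}"

definition P_set :: "nat \<Rightarrow> nat \<Rightarrow> nat \<Rightarrow> nat set set" where
  "P_set i j k =
    {{i, j}, {j, k}, {k, i}, {i, j \<star> k}, {j, k \<star> i}, {k, i \<star> j}}"

text \<open>\<open>T_set i j k\<close> is intended for generative \<open>i, j, k\<close>, i.e. pairwise distinct points
  of \<open>idx\<close> with \<open>k \<noteq> i \<star> j\<close>.\<close>

definition T_set :: "nat \<Rightarrow> nat \<Rightarrow> nat \<Rightarrow> nat set set" where
  "T_set i j k =
    P_set i j k \<union> {{i, i \<star> j}, {i, i \<star> k}, {i \<star> j, i \<star> k}, {i, i \<star> j \<star> k}}"

definition gen_nice :: "nat set set \<Rightarrow> bool" where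
  "gen_nice T \<longleftrightarrow> T \<subseteq> X0 \<and>
    (\<forall>i\<in>idx0. \<forall>j\<in>idx0. \<forall>k\<in>idx0.
      {i, j} \<in> T \<longrightarrow> {i \<star> j, k} \<in> T \<longrightarrow> P_set i j k \<subseteq> T)"

text \<open>For \<open>S \<subseteq> X0\<close> the intersected family contains \<open>X0\<close> and is closed under intersection,
  so this is the smallest generalised nice set containing \<open>S\<close>.\<close>

definition gen_nice_hull :: "nat set set \<Rightarrow> nat set set" where
  "gen_nice_hull S = \<Inter> {T. gen_nice T \<and> S \<subseteq> T}"

end

theory Submission
  imports Defs
begin

text \<open>The operation makes \<open>idx0\<close> an elementary abelian group of order 8. Since \<open>{1}\<close> and \<open>{0, 2}\<close>
  lie in \<open>T\<close>, every pair \<open>{i, j}\<close> of \<open>T\<close> satisfies \<open>{1, i \<star> j} \<in> T\<close>, so niceness allows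
  replacing \<open>j\<close> by \<open>j \<star> 1\<close>: \<open>T\<close> is the preimage of a set of unordered pairs in the quotient by
  \<open>{0, 1}\<close>, a Klein four-group \<open>{0, a, b, c}\<close> with \<open>a\<close>, \<open>b\<close>, \<open>c\<close> represented by 2, 3, 4. There
  only the pairs \<open>0b, 0c, aa, bb, cc, ab, ac, bc\<close> are undetermined, and niceness leaves
  twelve possibilities for them.\<close>

declare One_nat_def [simp del]

section \<open>The Fano plane and its multiplication table\<close>

lemma finite_fano_line: "l \<in> fano_lines \<Longrightarrow> finite l"
  unfolding fano_lines_def by auto

lemma card_fano_line_Int:
  assumes "l \<in> fano_lines" "m \<in> fano_lines" "l \<noteq> m"
  shows "card (l \<inter> m) < 2"
  using assms unfolding fano_lines_def insert_iff empty_iff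
  by (elim disjE; simp only: simp_thms; simp)

text \<open>Makes the third point well defined: \<open>fano_op_eqI\<close> relies on it to evaluate
  the definite description in \<open>fano_op\<close>.\<close>

lemma fano_line_unique:
  assumes "l \<in> fano_lines" "m \<in> fano_lines" "i \<in> l" "j \<in> l" "i \<in> m" "j \<in> m" "i \<noteq> j"
  shows "l = m"
proof (rule ccontr)
  assume "l \<noteq> m"
  moreover have "card {i, j} \<le> card (l \<inter> m)"
    using assms(3-6) finite_fano_line[OF assms(1)] by (intro card_mono) auto
  ultimately show False
    using card_fano_line_Int[OF assms(1,2)] assms(7) by simp
qed

lemma fano_op_eqI:
  assumes "{i, j, k} \<in> fano_lines" "i \<noteq> 0" "j \<noteq> 0" "i \<noteq> j" "k \<noteq> i" "k \<noteq> j"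
  shows "i \<star> j = k"
proof -
  have "k' = k" if "k' \<noteq> i \<and> k' \<noteq> j \<and> {i, j, k'} \<in> fano_lines" for k'
  proof -
    have "k' \<in> {i, j, k'}"
      by simp
    also have "{i, j, k'} = {i, j, k}"
      by (rule fano_line_unique[of _ _ i j]) (use that assms in simp_all)
    finally show ?thesis
      using that by simp
  qed
  then have "(THE k. k \<noteq> i \<and> k \<noteq> j \<and> {i, j, k} \<in> fano_lines) = k"
    using assms by (intro the_equality) blast+
  then show ?thesis
    unfolding fano_op_def using assms(2-4) by simp
qed

lemma fano_op_0 [simp]: "0 \<star> i = i" "i \<star> 0 = i" "i \<star> i = 0"
  by (simp_all add: fano_op_def)

text \<open>Each line accounts for six products, one per ordered pair of its points, so the seven
  lines yield all 42 entries of \<open>fano_op_table\<close>.\<close>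

lemma fano_op_line:
  assumes "{i, j, k} \<in> fano_lines" "0 \<notin> {i, j, k}" "distinct [i, j, k]"
  shows "i \<star> j = k" "j \<star> i = k" "i \<star> k = j" "k \<star> i = j" "j \<star> k = i" "k \<star> j = i"
  by (rule fano_op_eqI; use assms in \<open>simp add: insert_commute\<close>)+

lemma fano_lines_mem:
  "{1, 2, 5} \<in> fano_lines" "{5, 6, 7} \<in> fano_lines" "{1, 4, 7} \<in> fano_lines"
  "{1, 3, 6} \<in> fano_lines" "{2, 4, 6} \<in> fano_lines" "{2, 3, 7} \<in> fano_lines"
  "{3, 4, 5} \<in> fano_lines"
  unfolding fano_lines_def by simp_all

lemma fano_op_table [simp]:
  "1 \<star> 2 = 5" "1 \<star> 3 = 6" "1 \<star> 4 = 7" "1 \<star> 5 = 2" "1 \<star> 6 = 3" "1 \<star> 7 = 4"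
  "2 \<star> 1 = 5" "2 \<star> 3 = 7" "2 \<star> 4 = 6" "2 \<star> 5 = 1" "2 \<star> 6 = 4" "2 \<star> 7 = 3"
  "3 \<star> 1 = 6" "3 \<star> 2 = 7" "3 \<star> 4 = 5" "3 \<star> 5 = 4" "3 \<star> 6 = 1" "3 \<star> 7 = 2"
  "4 \<star> 1 = 7" "4 \<star> 2 = 6" "4 \<star> 3 = 5" "4 \<star> 5 = 3" "4 \<star> 6 = 2" "4 \<star> 7 = 1"
  "5 \<star> 1 = 2" "5 \<star> 2 = 1" "5 \<star> 3 = 4" "5 \<star> 4 = 3" "5 \<star> 6 = 7" "5 \<star> 7 = 6"
  "6 \<star> 1 = 3" "6 \<star> 2 = 4" "6 \<star> 3 = 1" "6 \<star> 4 = 2" "6 \<star> 5 = 7" "6 \<star> 7 = 5"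
  "7 \<star> 1 = 4" "7 \<star> 2 = 3" "7 \<star> 3 = 2" "7 \<star> 4 = 1" "7 \<star> 5 = 6" "7 \<star> 6 = 5"
  by (simp_all add: fano_lines_mem[THEN fano_op_line(1)] fano_lines_mem[THEN fano_op_line(2)]
    fano_lines_mem[THEN fano_op_line(3)] fano_lines_mem[THEN fano_op_line(4)]
    fano_lines_mem[THEN fano_op_line(5)] fano_lines_mem[THEN fano_op_line(6)])

lemma idx0_eq: "idx0 = {0, 1, 2, 3, 4, 5, 6, 7}"
  unfolding idx0_def idx_def by auto

lemma fano_op_commute:
  assumes "i \<in> idx0" "j \<in> idx0"
  shows "i \<star> j = j \<star> i"
  using assms unfolding idx0_eq by auto

lemma fano_op_cancel_1:
  assumes "i \<in> idx0"
  shows "i \<star> 1 \<star> 1 = i"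
  using assms unfolding idx0_eq by auto

section \<open>Explicit lists of pairs\<close>

lemma pair_mem_X_iff: "{i, j} \<in> X \<longleftrightarrow> i \<in> idx \<and> j \<in> idx \<and> i \<noteq> j"
  unfolding X_def by (auto simp: doubleton_eq_iff)

text \<open>The smaller point comes first in every pair; \<open>mem_quot\<close> uses the same
  normal form, so membership in \<open>T\<close> can be decided entry by entry.\<close>

lemma X_eq:
  "X = {{1, 2}, {1, 3}, {1, 4}, {1, 5}, {1, 6}, {1, 7},
    {2, 3}, {2, 4}, {2, 5}, {2, 6}, {2, 7},
    {3, 4}, {3, 5}, {3, 6}, {3, 7},
    {4, 5}, {4, 6}, {4, 7},
    {5, 6}, {5, 7},
    {6, 7}}"
proof -
  have "X = (\<Union>i\<in>idx. \<Union>j\<in>idx - {i}. {{i, j}})"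
    unfolding X_def by auto
  also have "idx = {1, 2, 3, 4, 5, 6, 7}"
    unfolding idx_def by auto
  finally show ?thesis
    by (simp add: insert_Diff_if insert_commute)
qed

lemma XE_eq: "XE = {{0}, {1}, {2}, {3}, {4}, {5}, {6}, {7}}"
  unfolding XE_def idx0_eq by auto

section \<open>Consequences of niceness\<close>

lemma gen_nice_idx0:
  assumes "gen_nice T" "{i, j} \<in> T"
  shows "i \<in> idx0" "j \<in> idx0"
proof -
  have "{i, j} \<in> X0"
    using assms unfolding gen_nice_def by blast
  then show "i \<in> idx0" "j \<in> idx0"
    unfolding X0_def by (auto simp: doubleton_eq_iff)
qed

text \<open>Since \<open>T\<close> lies in \<open>X0\<close>, the premises already put all three
  indices in \<open>idx0\<close>, and niceness becomes a rule without range conditions.\<close>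

lemma gen_niceD:
  assumes "gen_nice T" "{i, j} \<in> T" "{i \<star> j, k} \<in> T"
  shows "{j, k} \<in> T" "{i, k} \<in> T" "{i, j \<star> k} \<in> T"
proof -
  have "P_set i j k \<subseteq> T"
    using assms gen_nice_idx0[OF assms(1,2)] gen_nice_idx0[OF assms(1,3)]
    unfolding gen_nice_def by blast
  then show "{j, k} \<in> T" "{i, k} \<in> T" "{i, j \<star> k} \<in> T"
    unfolding P_set_def by (auto simp: insert_commute)
qed

text \<open>Niceness with \<open>i = j = x\<close>, where \<open>x \<star> x = 0\<close>.\<close>

lemma gen_nice_singletonD:
  assumes "gen_nice T" "{x} \<in> T" "{0, z} \<in> T"
  shows "{x, z} \<in> T" "{x, x \<star> z} \<in> T"
  using gen_niceD[of T x x z] assms by simp_all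

text \<open>Niceness with \<open>k = i = x\<close>, where the pair \<open>{k, i}\<close> degenerates
  to \<open>{x}\<close>.\<close>

lemma gen_nice_singletonI:
  assumes "gen_nice T" "{x, y} \<in> T" "{x, x \<star> y} \<in> T"
  shows "{x} \<in> T"
  using gen_niceD(2)[of T x y x] assms by (simp add: insert_commute)

lemma swap_reps:
  "{2, 0} = {0, 2 :: nat}" "{3, 0} = {0, 3 :: nat}" "{4, 0} = {0, 4 :: nat}"
  "{3, 2} = {2, 3 :: nat}" "{4, 2} = {2, 4 :: nat}" "{4, 3} = {3, 4 :: nat}"
  by auto

section \<open>Passage to the quotient by \<open>{0, 1}\<close>\<close>

context
  fixes T :: "nat set set"
  assumes nice: "gen_nice T" and base: "P_set 1 2 1 \<subseteq> T"
begin

lemma base_mem: "{0} \<in> T" "{1} \<in> T" "{0, 1} \<in> T" "{0, 2} \<in> T" "{0, 5} \<in> T" "{1, 2} \<in> T"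
proof -
  show 1: "{1} \<in> T" and 12: "{1, 2} \<in> T" and "{0, 2} \<in> T"
    using base unfolding P_set_def by (auto simp: insert_commute)
  have "{2, 0} \<in> T" "{5, 1} \<in> T"
    using base unfolding P_set_def by (auto simp: insert_commute)
  \<comment> \<open>As \<open>0\<close> is neutral, \<open>{0, i}\<close> and \<open>{i, k}\<close>
    in \<open>T\<close> give \<open>{0, k}\<close> and \<open>{0, i \<star> k}\<close>; this yields
    the three remaining pairs.\<close>
  then show 01: "{0, 1} \<in> T"
    using gen_niceD(2)[OF nice, of 0 2 1] 12 by (simp add: insert_commute)
  then show "{0} \<in> T"
    using gen_niceD(3)[OF nice, of 0 1 1] 1 by simp
  show "{0, 5} \<in> T"
    using gen_niceD(3)[OF nice, of 0 1 2] 01 12 by simp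
qed

lemma mem_0_iff_mem_1: "{0, k} \<in> T \<longleftrightarrow> {1, k} \<in> T"
  using gen_nice_singletonD(1)[OF nice, of 1 k] gen_niceD(2)[OF nice, of 0 1 k] base_mem
  by auto

lemma mem_0_op:
  assumes "{i, j} \<in> T"
  shows "{0, i \<star> j} \<in> T"
proof -
  have ij: "i \<in> idx0" "j \<in> idx0"
    using gen_nice_idx0[OF nice assms] .
  have *: "{0, i' \<star> j'} \<in> T" if "{0, i'} \<in> T" "{i', j'} \<in> T" for i' j'
    using gen_niceD(3)[OF nice, of 0 i' j'] that by simp
  \<comment> \<open>\<open>{0, 1, 2, 5}\<close> is a subgroup of index 2, so it contains
    \<open>i\<close>, \<open>j\<close> or \<open>i \<star> j\<close>, and \<open>base_mem\<close>
    gives \<open>{0, x} \<in> T\<close> for each of its elements \<open>x\<close>.\<close>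
  consider "i \<in> {0, 1, 2, 5}" | "j \<in> {0, 1, 2, 5}" | "i \<star> j \<in> {0, 1, 2, 5}"
    using ij unfolding idx0_eq by auto
  then show ?thesis
  proof cases
    case 1
    then show ?thesis using *[of i j] assms base_mem by auto
  next
    case 2
    then show ?thesis
      using *[of j i] assms base_mem fano_op_commute[OF ij] by (auto simp: insert_commute)
  next
    case 3
    then show ?thesis using base_mem by auto
  qed
qed

text \<open>By \<open>mem_0_op\<close> the pair \<open>{i \<star> j, 1}\<close> lies in
  \<open>T\<close>, so niceness with \<open>k = 1\<close> gives \<open>{i, 1}\<close> and hence
  \<open>{0, i}\<close>.\<close>

lemma mem_0_left:
  assumes "{i, j} \<in> T"
  shows "{0, i} \<in> T"
  using gen_niceD(2)[OF nice assms, of 1] mem_0_op[OF assms]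
  by (simp add: mem_0_iff_mem_1 insert_commute)

lemma mem_op_1_iff:
  assumes "j \<in> idx0"
  shows "{i, j \<star> 1} \<in> T \<longleftrightarrow> {i, j} \<in> T"
proof -
  have *: "{i, j' \<star> 1} \<in> T" if "{i, j'} \<in> T" for j'
    using gen_niceD(3)[OF nice that, of 1] mem_0_op[OF that]
    by (simp add: mem_0_iff_mem_1 insert_commute)
  show ?thesis
    \<comment> \<open>Multiplication by \<open>1\<close> is an involution, so the implication at
      \<open>j \<star> 1\<close> is the converse.\<close>
    using *[of j] *[of "j \<star> 1"] fano_op_cancel_1[OF assms] by auto
qed

text \<open>The cosets are \<open>{0, 1}\<close>, \<open>{2, 5}\<close>, \<open>{3, 6}\<close> and
  \<open>{4, 7}\<close>, represented by their smallest elements.\<close>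

lemma mem_right_quot:
  "{i, 1} \<in> T \<longleftrightarrow> {i, 0} \<in> T" "{i, 5} \<in> T \<longleftrightarrow> {i, 2} \<in> T"
  "{i, 6} \<in> T \<longleftrightarrow> {i, 3} \<in> T" "{i, 7} \<in> T \<longleftrightarrow> {i, 4} \<in> T"
  using mem_op_1_iff[of 0 i] mem_op_1_iff[of 2 i] mem_op_1_iff[of 3 i] mem_op_1_iff[of 4 i]
  by (simp_all add: idx0_eq)

lemma mem_left_quot:
  "{1, i} \<in> T \<longleftrightarrow> {0, i} \<in> T" "{5, i} \<in> T \<longleftrightarrow> {2, i} \<in> T"
  "{6, i} \<in> T \<longleftrightarrow> {3, i} \<in> T" "{7, i} \<in> T \<longleftrightarrow> {4, i} \<in> T"
  using mem_right_quot[of i] by (simp_all add: insert_commute)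

lemma mem_singleton_quot:
  "{5} \<in> T \<longleftrightarrow> {2} \<in> T" "{6} \<in> T \<longleftrightarrow> {3} \<in> T" "{7} \<in> T \<longleftrightarrow> {4} \<in> T"
  using mem_left_quot(2)[of 5] mem_left_quot(3)[of 6] mem_left_quot(4)[of 7]
  by (simp_all add: mem_right_quot)

text \<open>These 26 pairs, the pairs \<open>{0}\<close> and \<open>{0, 2}\<close> of
  \<open>base_mem\<close>, and the eight undetermined ones exhaust \<open>X0\<close>.\<close>

lemma mem_quot:
  "{0, 1} \<in> T" "{0, 5} \<in> T"
  "{0, 6} \<in> T \<longleftrightarrow> {0, 3} \<in> T" "{0, 7} \<in> T \<longleftrightarrow> {0, 4} \<in> T"
  "{1} \<in> T" "{1, 2} \<in> T"
  "{1, 3} \<in> T \<longleftrightarrow> {0, 3} \<in> T" "{1, 4} \<in> T \<longleftrightarrow> {0, 4} \<in> T"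
  "{1, 5} \<in> T" "{1, 6} \<in> T \<longleftrightarrow> {0, 3} \<in> T"
  "{1, 7} \<in> T \<longleftrightarrow> {0, 4} \<in> T" "{2, 5} \<in> T \<longleftrightarrow> {2} \<in> T"
  "{2, 6} \<in> T \<longleftrightarrow> {2, 3} \<in> T" "{2, 7} \<in> T \<longleftrightarrow> {2, 4} \<in> T"
  "{3, 5} \<in> T \<longleftrightarrow> {2, 3} \<in> T" "{3, 6} \<in> T \<longleftrightarrow> {3} \<in> T"
  "{3, 7} \<in> T \<longleftrightarrow> {3, 4} \<in> T" "{4, 5} \<in> T \<longleftrightarrow> {2, 4} \<in> T"
  "{4, 6} \<in> T \<longleftrightarrow> {3, 4} \<in> T" "{4, 7} \<in> T \<longleftrightarrow> {4} \<in> T"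
  "{5} \<in> T \<longleftrightarrow> {2} \<in> T" "{5, 6} \<in> T \<longleftrightarrow> {2, 3} \<in> T"
  "{5, 7} \<in> T \<longleftrightarrow> {2, 4} \<in> T" "{6} \<in> T \<longleftrightarrow> {3} \<in> T"
  "{6, 7} \<in> T \<longleftrightarrow> {3, 4} \<in> T" "{7} \<in> T \<longleftrightarrow> {4} \<in> T"
  by (simp_all add: mem_left_quot mem_right_quot mem_singleton_quot base_mem swap_reps)

text \<open>View \<open>ab\<close>, \<open>ac\<close>, \<open>bc\<close> as the edges of a triangle.
  Any edge forces \<open>b\<close> and \<open>c\<close>; once both hold, \<open>aa\<close>,
  \<open>bb\<close> or \<open>cc\<close> holds exactly when both edges at that vertex do, so the 8
  sets of edges give the last eight cases. Without \<open>b\<close> and \<open>c\<close> together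
  there are no edges, which leaves the first four.\<close>

lemma quotient_cases:
  defines "b \<equiv> {0, 3} \<in> T" and "c \<equiv> {0, 4} \<in> T"
    and "aa \<equiv> {2} \<in> T" and "bb \<equiv> {3} \<in> T" and "cc \<equiv> {4} \<in> T"
    and "ab \<equiv> {2, 3} \<in> T" and "ac \<equiv> {2, 4} \<in> T" and "bc \<equiv> {3, 4} \<in> T"
  obtains
    "\<not> b" "\<not> c" "\<not> aa" "\<not> bb" "\<not> cc" "\<not> ab" "\<not> ac" "\<not> bc"
  |
    "\<not> b" "\<not> c" "aa" "\<not> bb" "\<not> cc" "\<not> ab" "\<not> ac" "\<not> bc"
  |
    "b" "\<not> c" "\<not> aa" "\<not> bb" "\<not> cc" "\<not> ab" "\<not> ac" "\<not> bc"
  |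
    "\<not> b" "c" "\<not> aa" "\<not> bb" "\<not> cc" "\<not> ab" "\<not> ac" "\<not> bc"
  |
    "b" "c" "\<not> aa" "\<not> bb" "\<not> cc" "\<not> ab" "\<not> ac" "\<not> bc"
  |
    "b" "c" "\<not> aa" "\<not> bb" "\<not> cc" "ab" "\<not> ac" "\<not> bc"
  |
    "b" "c" "\<not> aa" "\<not> bb" "\<not> cc" "\<not> ab" "ac" "\<not> bc"
  |
    "b" "c" "\<not> aa" "\<not> bb" "\<not> cc" "\<not> ab" "\<not> ac" "bc"
  |
    "b" "c" "aa" "\<not> bb" "\<not> cc" "ab" "ac" "\<not> bc"
  |
    "b" "c" "\<not> aa" "bb" "\<not> cc" "ab" "\<not> ac" "bc"
  |
    "b" "c" "\<not> aa" "\<not> bb" "cc" "\<not> ab" "ac" "bc"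
  |
    "b" "c" "aa" "bb" "cc" "ab" "ac" "bc"
proof -
  \<comment> \<open>The endpoints and the product of an edge represent all three nonzero
    classes.\<close>
  have edge: "b \<and> c" if "ab \<or> ac \<or> bc"
  proof -
    have "{2, 3} \<in> T \<Longrightarrow> {0, 3} \<in> T \<and> {0, 4} \<in> T"
      using mem_0_left[of 3 2] mem_0_op[of 2 3] by (simp add: mem_quot swap_reps)
    moreover have "{2, 4} \<in> T \<Longrightarrow> {0, 3} \<in> T \<and> {0, 4} \<in> T"
      using mem_0_left[of 4 2] mem_0_op[of 2 4] by (simp add: mem_quot swap_reps)
    moreover have "{3, 4} \<in> T \<Longrightarrow> {0, 3} \<in> T \<and> {0, 4} \<in> T"
      using mem_0_left[of 3 4] mem_0_left[of 4 3] by (simp add: swap_reps)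
    ultimately show ?thesis
      using that unfolding b_def c_def ab_def ac_def bc_def by blast
  qed
  \<comment> \<open>A pair joining \<open>0\<close> to another class is required here; for
    \<open>bb\<close> and \<open>cc\<close> it is \<open>{0, 2}\<close>, which always lies in
    \<open>T\<close>.\<close>
  have aa: "ab \<and> ac" if "aa" "b \<or> c"
    using that gen_nice_singletonD[OF nice, of 2 3] gen_nice_singletonD[OF nice, of 2 4]
    unfolding aa_def ab_def ac_def b_def c_def by (auto simp: mem_quot)
  have bb: "ab \<and> bc" if "bb"
    using that gen_nice_singletonD[OF nice, of 3 2] base_mem
    unfolding bb_def ab_def bc_def by (simp add: mem_quot swap_reps)
  have cc: "ac \<and> bc" if "cc"
    using that gen_nice_singletonD[OF nice, of 4 2] base_mem
    unfolding cc_def ac_def bc_def by (simp add: mem_quot mem_right_quot swap_reps)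
  have aaI: "aa" if "ab" "ac"
    using that gen_nice_singletonI[OF nice, of 2 3]
    unfolding aa_def ab_def ac_def by (simp add: mem_quot)
  have bbI: "bb" if "ab" "bc"
    using that gen_nice_singletonI[OF nice, of 3 2]
    unfolding bb_def ab_def bc_def by (simp add: mem_quot swap_reps)
  have ccI: "cc" if "ac" "bc"
    using that gen_nice_singletonI[OF nice, of 4 2]
    unfolding cc_def ac_def bc_def by (simp add: mem_quot mem_right_quot swap_reps)
  show thesis
    using that edge aa bb cc aaI bbI ccI by argo
qed

end

section \<open>The named sets of pairs and the twelve cases\<close>

lemma X_point_1_eq: "X_point 1 = {{1, l} | l. l \<in> {2..7}}"
proof -
  have "{1, j} \<in> X \<and> j \<noteq> 1 \<longleftrightarrow> j \<in> {2..7}" for j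
    unfolding pair_mem_X_iff idx_def by auto
  then show ?thesis
    unfolding X_point_def by blast
qed

text \<open>Written as a filter on \<open>X\<close>, the set can be evaluated on the list
  \<open>X_eq\<close>; the next two lemmas serve the same end.\<close>

lemma X_point_eq: "X_point i = X \<inter> {p. i \<in> p}"
  unfolding X_point_def X_def by blast

lemma X_line_eq: "X_line l = X \<inter> {p. p \<subseteq> l}"
  unfolding X_line_def X_def by blast

lemma X_Diff_X_line_compl_eq: "X - X_line_compl l = X \<inter> {p. p \<inter> l \<noteq> {}}"
  unfolding X_line_compl_def X_def by blast

lemma subset_gen_nice_hull: "S \<subseteq> gen_nice_hull S"
  unfolding gen_nice_hull_def by blast

theorem theorem5p6:
  fixes T :: "nat set set"
  assumes "gen_nice T"
    and "gen_nice_hull (P_set 1 2 1) \<subseteq> T"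
  shows
    "(card (T \<inter> XE) = 2 \<longrightarrow>
        card (T \<inter> X) \<in> {2, 4, 6, 10} \<and>
        (card (T \<inter> X) = 2 \<longrightarrow> T \<inter> X = {{1, 2}, {1, 5}}) \<and>
        (card (T \<inter> X) = 4 \<longrightarrow>
          (\<exists>k\<in>{3, 4, 6, 7}. T \<inter> X = {{1, 2}, {1, k}, {1, 5}, {1, k \<star> 1}})) \<and>
        (card (T \<inter> X) = 6 \<longrightarrow>
          T \<inter> X = X_point 1 \<and> X_point 1 = {{1, l} | l. l \<in> {2..7}}) \<and>
        (card (T \<inter> X) = 10 \<longrightarrow>
          (\<exists>j\<in>{2, 5}. \<exists>k\<in>{3, 4, 6, 7}.
            T \<inter> X = T_set 1 j k \<or> T \<inter> X = T_set 1 (j \<star> k) k)))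
     \<and>
     (card (T \<inter> XE) > 2 \<longrightarrow>
        card (T \<inter> X) \<in> {3, 15, 21} \<and>
        (card (T \<inter> X) = 3 \<longrightarrow> T \<inter> X = X_line (line_through 1 2)) \<and>
        (card (T \<inter> X) = 15 \<longrightarrow>
          (\<exists>s\<in>idx - {1}. T \<inter> X = X - X_line_compl (line_through 1 s))) \<and>
        (card (T \<inter> X) = 21 \<longrightarrow> T \<inter> X = X))"
proof -
  have base: "P_set 1 2 1 \<subseteq> T"
    using assms(2) subset_gen_nice_hull by blast
  note mem = mem_quot[OF assms(1) base] base_mem[OF assms(1) base]
  note explicit = X_eq XE_eq Int_insert_left Int_insert_right
  show ?thesis
  proof (cases rule: quotient_cases[OF assms(1) base])
    case 1
    \<comment> \<open>\<open>{0}\<close> and \<open>{1}\<close> always lie in \<open>T\<close>, and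
      each of \<open>aa\<close>, \<open>bb\<close>, \<open>cc\<close> contributes two further
      singletons.\<close>
    have "card (T \<inter> XE) = 2" "card (T \<inter> X) = 2"
      by (simp_all add: explicit mem 1 doubleton_eq_iff)
    moreover have "T \<inter> X = {{1, 2}, {1, 5}}"
      by (simp add: explicit mem 1)
    ultimately show ?thesis
      by auto
  next
    case 2
    have "card (T \<inter> XE) = 4" "card (T \<inter> X) = 3"
      by (simp_all add: explicit mem 2 doubleton_eq_iff)
    moreover have "T \<inter> X = X_line (line_through 1 2)"
      by (simp add: explicit mem 2 X_line_eq line_through_def)
    ultimately show ?thesis
      by auto
  next
    case 3
    have "card (T \<inter> XE) = 2" "card (T \<inter> X) = 4"
      by (simp_all add: explicit mem 3 doubleton_eq_iff)
    moreover have "T \<inter> X = {{1, 2}, {1, 3}, {1, 5}, {1, 3 \<star> 1}}"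
      by (simp add: explicit mem 3)
    ultimately show ?thesis
      by auto
  next
    case 4
    have "card (T \<inter> XE) = 2" "card (T \<inter> X) = 4"
      by (simp_all add: explicit mem 4 doubleton_eq_iff)
    moreover have "T \<inter> X = {{1, 2}, {1, 4}, {1, 5}, {1, 4 \<star> 1}}"
      by (simp add: explicit mem 4)
    ultimately show ?thesis
      by auto
  next
    case 5
    have "card (T \<inter> XE) = 2" "card (T \<inter> X) = 6"
      by (simp_all add: explicit mem 5 doubleton_eq_iff)
    moreover have "T \<inter> X = X_point 1"
      by (simp add: explicit mem 5 X_point_eq)
    ultimately show ?thesis
      using X_point_1_eq by simp
  next
    case 6
    have "card (T \<inter> XE) = 2" "card (T \<inter> X) = 10"
      by (simp_all add: explicit mem 6 doubleton_eq_iff)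
    \<comment> \<open>\<open>T_set 1 2 3\<close> is \<open>X_point 1\<close> plus the four pairs
      joining the classes \<open>{2, 5}\<close> and \<open>{3, 6}\<close>.\<close>
    moreover have "T \<inter> X = T_set 1 2 3"
      by (simp add: explicit mem 6 T_set_def P_set_def) (simp add: insert_commute)
    ultimately show ?thesis
      by auto
  next
    case 7
    have "card (T \<inter> XE) = 2" "card (T \<inter> X) = 10"
      by (simp_all add: explicit mem 7 doubleton_eq_iff)
    moreover have "T \<inter> X = T_set 1 2 4"
      by (simp add: explicit mem 7 T_set_def P_set_def) (simp add: insert_commute)
    ultimately show ?thesis
      by auto
  next
    case 8
    have "card (T \<inter> XE) = 2" "card (T \<inter> X) = 10"
      by (simp_all add: explicit mem 8 doubleton_eq_iff)
    \<comment> \<open>The edge \<open>bc\<close> avoids the class of \<open>2\<close>;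
      \<open>2 \<star> 3 = 7\<close> represents the class of \<open>4\<close>, hence the form with
      \<open>j \<star> k\<close>.\<close>
    moreover have "T \<inter> X = T_set 1 (2 \<star> 3) 3"
      by (simp add: explicit mem 8 T_set_def P_set_def) (simp add: insert_commute)
    ultimately show ?thesis
      by auto
  next
    case 9
    have "card (T \<inter> XE) = 4" "card (T \<inter> X) = 15"
      by (simp_all add: explicit mem 9 doubleton_eq_iff)
    \<comment> \<open>The line through \<open>1\<close> and \<open>s\<close> is \<open>1\<close>
      with the class of \<open>s\<close>; \<open>s\<close> is taken from the vertex where the two
      edges meet.\<close>
    moreover have "T \<inter> X = X - X_line_compl (line_through 1 2)"
      unfolding X_Diff_X_line_compl_eq by (simp add: explicit mem 9 line_through_def)
    ultimately show ?thesis
      by (auto simp: idx_def)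
  next
    case 10
    have "card (T \<inter> XE) = 4" "card (T \<inter> X) = 15"
      by (simp_all add: explicit mem 10 doubleton_eq_iff)
    moreover have "T \<inter> X = X - X_line_compl (line_through 1 3)"
      unfolding X_Diff_X_line_compl_eq by (simp add: explicit mem 10 line_through_def)
    ultimately show ?thesis
      by (auto simp: idx_def)
  next
    case 11
    have "card (T \<inter> XE) = 4" "card (T \<inter> X) = 15"
      by (simp_all add: explicit mem 11 doubleton_eq_iff)
    moreover have "T \<inter> X = X - X_line_compl (line_through 1 4)"
      unfolding X_Diff_X_line_compl_eq by (simp add: explicit mem 11 line_through_def)
    ultimately show ?thesis
      by (auto simp: idx_def)
  next
    case 12
    have "card (T \<inter> XE) = 8" "card (T \<inter> X) = 21"
      by (simp_all add: explicit mem 12 doubleton_eq_iff)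
    moreover have "T \<inter> X = X"
      by (simp add: explicit mem 12)
    ultimately show ?thesis
      by auto
  qed
qed

end
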